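(* Let $L$ be a Latin square of even order $n$ that contains a subsquare $A$ of order $n/2$, and suppose that $A$ has a near-transversal. Then for every integer $\ell$ with $\frac n2<\ell\le\frac34 n$ and $\ell-\frac n2$ even, $L$ contains a maximal partial transversal of length $\ell$.
   Context: Latin squares are viewed as sets of triples $(r,c,s)$ with $s$ the symbol in cell $(r,c)$. A subsquare is a submatrix (a choice of rows and of columns) that is itself a Latin square. A partial transversal is a set of triples containing at most one triple in each row, at most one in each column, and at most one with each symbol; its length is its number of triples. It is maximal if not contained in a longer partial transversal. A near-transversal of a Latin square of order $k$ is a partial transversal of it of length $k-1$. *)

theory Defs imports Main begin

text \<open>Rows, columns and symbols range over arbitrary index sets \<open>R\<close>, \<open>C\<close>, \<open>S\<close>, so that a
  subsquare, which lives on subsets of the index sets, is literally a Latin square again.\<close>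

definition latin_square ::
    "nat \<Rightarrow> 'r set \<Rightarrow> 'c set \<Rightarrow> 's set \<Rightarrow> ('r \<times> 'c \<times> 's) set \<Rightarrow> bool" where
  "latin_square n R C S L \<longleftrightarrow>
     finite R \<and> finite C \<and> finite S \<and> card R = n \<and> card C = n \<and> card S = n \<and>
     L \<subseteq> R \<times> C \<times> S \<and>
     (\<forall>r\<in>R. \<forall>c\<in>C. \<exists>!s. (r, c, s) \<in> L) \<and>
     (\<forall>r\<in>R. \<forall>s\<in>S. \<exists>!c. (r, c, s) \<in> L) \<and>
     (\<forall>c\<in>C. \<forall>s\<in>S. \<exists>!r. (r, c, s) \<in> L)"

definition submatrix :: "('r \<times> 'c \<times> 's) set \<Rightarrow> 'r set \<Rightarrow> 'c set \<Rightarrow> ('r \<times> 'c \<times> 's) set" where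
  "submatrix L R' C' = {(r, c, s) \<in> L. r \<in> R' \<and> c \<in> C'}"

definition subsquare ::
    "nat \<Rightarrow> ('r \<times> 'c \<times> 's) set \<Rightarrow> 'r set \<Rightarrow> 'c set \<Rightarrow> ('r \<times> 'c \<times> 's) set \<Rightarrow> bool" where
  "subsquare k A R C L \<longleftrightarrow>
     (\<exists>R' C' S'. R' \<subseteq> R \<and> C' \<subseteq> C \<and> A = submatrix L R' C' \<and> latin_square k R' C' S' A)"

definition partial_transversal :: "('r \<times> 'c \<times> 's) set \<Rightarrow> ('r \<times> 'c \<times> 's) set \<Rightarrow> bool" where
  "partial_transversal L T \<longleftrightarrow>
     T \<subseteq> L \<and> inj_on (\<lambda>(r, c, s). r) T \<and> inj_on (\<lambda>(r, c, s). c) T \<and> inj_on (\<lambda>(r, c, s). s) T"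

definition maximal_partial_transversal ::
    "('r \<times> 'c \<times> 's) set \<Rightarrow> ('r \<times> 'c \<times> 's) set \<Rightarrow> bool" where
  "maximal_partial_transversal L T \<longleftrightarrow>
     partial_transversal L T \<and>
     \<not> (\<exists>T'. partial_transversal L T' \<and> T \<subseteq> T' \<and> card T < card T')"

text \<open>The length condition is written \<open>card T + 1 = k\<close> to avoid truncated subtraction.\<close>

definition near_transversal :: "nat \<Rightarrow> ('r \<times> 'c \<times> 's) set \<Rightarrow> ('r \<times> 'c \<times> 's) set \<Rightarrow> bool" where
  "near_transversal k A T \<longleftrightarrow> partial_transversal A T \<and> card T + 1 = k"

end

theory Submission imports Defs begin

text \<open>Write \<open>n = 2 k\<close> and \<open>l = k + 2 m\<close>, so that \<open>4 m \<le> k\<close>, and split \<open>L\<close> into the four blocks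
  determined by the rows and columns of \<open>A\<close>. Keep \<open>k - m\<close> triples of the near-transversal of \<open>A\<close>.
  Then greedily add \<open>m\<close> triples in the block to the right of \<open>A\<close>, covering the missing rows of \<open>A\<close>,
  \<open>m\<close> triples in the block below \<open>A\<close>, covering its missing columns, and \<open>m\<close> triples in the
  opposite block, covering its missing symbols. In each step a line has \<open>k\<close> available cells in the
  block, of which at most \<open>4 m - 2 < k\<close> are forbidden. The result has length \<open>k + 2 m\<close>, and it is
  maximal, since every triple of \<open>L\<close> has a row, a column or a symbol of \<open>A\<close> that is covered.\<close>

section \<open>Partial transversals and a criterion for maximality\<close>

lemma partial_transversal_iff:
  "partial_transversal L T \<longleftrightarrow>
     T \<subseteq> L \<and> inj_on fst T \<and> inj_on (\<lambda>t. fst (snd t)) T \<and> inj_on (\<lambda>t. snd (snd t)) T"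
  by (simp add: partial_transversal_def case_prod_beta')

lemma partial_transversal_mono:
  assumes "partial_transversal A T" "A \<subseteq> L" "T' \<subseteq> T"
  shows "partial_transversal L T'"
  using assms by (auto simp: partial_transversal_iff intro: inj_on_subset)

text \<open>A further triple in a partial transversal containing \<open>T\<close> would agree with
  some triple of \<open>T\<close> in a covered coordinate. Injectivity of that coordinate on the
  larger set then puts it into \<open>T\<close>.\<close>

lemma maximal_partial_transversalI:
  assumes T: "partial_transversal L T"
    and cover: "\<And>r c s. (r, c, s) \<in> L \<Longrightarrow>
      r \<in> fst ` T \<or> c \<in> (\<lambda>t. fst (snd t)) ` T \<or> s \<in> (\<lambda>t. snd (snd t)) ` T"
  shows "maximal_partial_transversal L T"
  unfolding maximal_partial_transversal_def
proof (intro conjI notI)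
  assume "\<exists>T'. partial_transversal L T' \<and> T \<subseteq> T' \<and> card T < card T'"
  then obtain T' where T': "partial_transversal L T'" "T \<subseteq> T'" "card T < card T'" by blast
  then obtain t where t: "t \<in> T'" "t \<notin> T" by (metis less_irrefl subsetI subset_antisym)
  have inj: "inj_on fst T'" "inj_on (\<lambda>t. fst (snd t)) T'" "inj_on (\<lambda>t. snd (snd t)) T'"
    and "t \<in> L"
    using T'(1) t(1) by (auto simp: partial_transversal_iff)
  then have "fst t \<in> fst ` T \<or> fst (snd t) \<in> (\<lambda>t. fst (snd t)) ` T
      \<or> snd (snd t) \<in> (\<lambda>t. snd (snd t)) ` T"
    using cover[of "fst t" "fst (snd t)" "snd (snd t)"] by simp
  then have "t \<in> T"
    using inj[THEN inj_on_image_mem_iff, OF t(1) T'(2)] by simp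
  with t(2) show False ..
qed (fact T)

section \<open>Greedy choice of one triple per line\<close>

text \<open>Each conflicting \<open>p\<close> is determined by its value \<open>g p\<close>, which
  lies in \<open>G\<close> and is attained on \<open>T\<close>. Hence only triples of
  \<open>T\<close> that meet the block in question can forbid a candidate.\<close>

lemma card_conflicts_le:
  assumes "inj_on g P" "finite T" "g ` P \<subseteq> G"
  shows "card {p \<in> P. g p \<in> g ` T} \<le> card {t \<in> T. g t \<in> G}"
proof -
  have "card {p \<in> P. g p \<in> g ` T} = card (g ` {p \<in> P. g p \<in> g ` T})"
    using assms(1) by (intro card_image[symmetric] inj_on_subset[OF assms(1)]) auto
  also have "\<dots> \<le> card (g ` {t \<in> T. g t \<in> G})"
    using assms by (intro card_mono) auto
  also have "\<dots> \<le> card {t \<in> T. g t \<in> G}"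
    using assms(2) by (intro card_image_le) auto
  finally show ?thesis .
qed

text \<open>Each step lowers \<open>card X\<close> by one and raises the two conflict counts by at most one each, so
  the left-hand side of the assumption \<open>room\<close> does not increase.\<close>

lemma greedy_extension:
  assumes "finite X" "finite T"
    and "inj_on f T" "inj_on g T" "inj_on h T" "f ` T \<inter> X = {}"
    and "\<And>x. x \<in> X \<Longrightarrow> finite (P x) \<and> inj_on g (P x) \<and> inj_on h (P x) \<and>
           f ` P x \<subseteq> {x} \<and> g ` P x \<subseteq> G \<and> h ` P x \<subseteq> H \<and> k \<le> card (P x)"
    and room: "card {t \<in> T. g t \<in> G} + card {t \<in> T. h t \<in> H} + 2 * card X < k + 2"
  obtains U where "finite U" "U \<subseteq> (\<Union>x\<in>X. P x)" "f ` U = X" "T \<inter> U = {}" "card U = card X"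
    "inj_on f (T \<union> U)" "inj_on g (T \<union> U)" "inj_on h (T \<union> U)"
proof -
  have "\<exists>U. finite U \<and> U \<subseteq> (\<Union>x\<in>X. P x) \<and> f ` U = X \<and>
      inj_on f (T \<union> U) \<and> inj_on g (T \<union> U) \<and> inj_on h (T \<union> U)"
    using assms
  proof (induction X arbitrary: T rule: finite_induct)
    case empty
    then show ?case by (intro exI[of _ "{}"]) auto
  next
    case (insert x X)
    let ?a = "card {t \<in> T. g t \<in> G}" and ?b = "card {t \<in> T. h t \<in> H}"
    have P: "finite (P x)" "inj_on g (P x)" "inj_on h (P x)" "f ` P x \<subseteq> {x}" "g ` P x \<subseteq> G"
      "h ` P x \<subseteq> H" "k \<le> card (P x)"
      using insert.prems(6)[of x] by auto
    \<comment> \<open>The forbidden candidates. Conflicts in \<open>f\<close> need no count, since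
      every candidate has the \<open>f\<close>-value \<open>x\<close>, which \<open>T\<close> does
      not use.\<close>
    let ?K = "{p \<in> P x. g p \<in> g ` T} \<union> {p \<in> P x. h p \<in> h ` T}"
    have "card ?K \<le> card {p \<in> P x. g p \<in> g ` T} + card {p \<in> P x. h p \<in> h ` T}"
      by (rule card_Un_le)
    also have "\<dots> \<le> ?a + ?b"
      using P insert.prems(1) by (intro add_mono card_conflicts_le)
    \<comment> \<open>The element \<open>x\<close> alone contributes 2 to the left-hand side of
      \<open>room\<close>, which cancels the 2 on the right and leaves
      \<open>?a + ?b < k\<close>.\<close>
    also have "\<dots> < card (P x)"
      using insert.prems(7) insert.hyps P(7) by simp
    finally have "?K \<noteq> P x" by (metis less_irrefl)
    then obtain p where p: "p \<in> P x" "g p \<notin> g ` T" "h p \<notin> h ` T" by blast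
    have fp: "f p = x" using P(4) p(1) by auto
    then have fT: "f p \<notin> f ` T" using insert.prems(5) by auto
    have count: "card {t \<in> insert p T. Q t} \<le> Suc (card {t \<in> T. Q t})" for Q
    proof -
      have "card {t \<in> insert p T. Q t} \<le> card (insert p {t \<in> T. Q t})"
        using insert.prems(1) by (intro card_mono) auto
      also have "\<dots> \<le> Suc (card {t \<in> T. Q t})"
        by (rule card_insert_le_m1) auto
      finally show ?thesis .
    qed
    have "\<exists>U. finite U \<and> U \<subseteq> (\<Union>x\<in>X. P x) \<and> f ` U = X \<and>
        inj_on f (insert p T \<union> U) \<and> inj_on g (insert p T \<union> U) \<and> inj_on h (insert p T \<union> U)"
    proof (rule insert.IH)
      show "inj_on f (insert p T)" "inj_on g (insert p T)" "inj_on h (insert p T)"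
        using insert.prems(2-4) p fT by (auto simp: inj_on_insert)
      show "f ` insert p T \<inter> X = {}"
        using insert.prems(5) insert.hyps(2) fp by auto
      show "card {t \<in> insert p T. g t \<in> G} + card {t \<in> insert p T. h t \<in> H} + 2 * card X < k + 2"
        using count[of "\<lambda>t. g t \<in> G"] count[of "\<lambda>t. h t \<in> H"] insert.prems(7) insert.hyps by simp
    qed (use insert.prems in auto)
    then obtain U where "finite U" "U \<subseteq> (\<Union>x\<in>X. P x)" "f ` U = X"
      "inj_on f (insert p T \<union> U)" "inj_on g (insert p T \<union> U)" "inj_on h (insert p T \<union> U)"
      by blast
    then show ?case
      using p fp by (intro exI[of _ "insert p U"]) auto
  qed
  then obtain U where U: "finite U" "U \<subseteq> (\<Union>x\<in>X. P x)" "f ` U = X"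
    "inj_on f (T \<union> U)" "inj_on g (T \<union> U)" "inj_on h (T \<union> U)"
    by blast
  moreover have "T \<inter> U = {}" using U(3) assms(6) by auto
  moreover have "card U = card X"
    using U(3) card_image[OF inj_on_subset[OF U(4), of U]] by auto
  ultimately show ?thesis using that by blast
qed

section \<open>Uniqueness and existence of cells in a Latin square\<close>

lemma latin_square_unique:
  assumes "latin_square n R C S L"
  shows "(r, c, s) \<in> L \<Longrightarrow> (r, c, s') \<in> L \<Longrightarrow> s = s'"
    and "(r, c, s) \<in> L \<Longrightarrow> (r, c', s) \<in> L \<Longrightarrow> c = c'"
    and "(r, c, s) \<in> L \<Longrightarrow> (r', c, s) \<in> L \<Longrightarrow> r = r'"
proof -
  have mem: "r \<in> R \<and> c \<in> C \<and> s \<in> S" if "(r, c, s) \<in> L" for r c s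
    using that assms by (auto simp: latin_square_def)
  have ex1: "\<forall>r\<in>R. \<forall>c\<in>C. \<exists>!s. (r, c, s) \<in> L" "\<forall>r\<in>R. \<forall>s\<in>S. \<exists>!c. (r, c, s) \<in> L"
    "\<forall>c\<in>C. \<forall>s\<in>S. \<exists>!r. (r, c, s) \<in> L"
    using assms by (simp_all add: latin_square_def)
  show "(r, c, s) \<in> L \<Longrightarrow> (r, c, s') \<in> L \<Longrightarrow> s = s'"
    using ex1(1) mem by metis
  show "(r, c, s) \<in> L \<Longrightarrow> (r, c', s) \<in> L \<Longrightarrow> c = c'"
    using ex1(2) mem by metis
  show "(r, c, s) \<in> L \<Longrightarrow> (r', c, s) \<in> L \<Longrightarrow> r = r'"
    using ex1(3) mem by metis
qed

lemma latin_square_ex: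
  assumes "latin_square n R C S L"
  shows "r \<in> R \<Longrightarrow> c \<in> C \<Longrightarrow> \<exists>s\<in>S. (r, c, s) \<in> L"
    and "r \<in> R \<Longrightarrow> s \<in> S \<Longrightarrow> \<exists>c\<in>C. (r, c, s) \<in> L"
    and "c \<in> C \<Longrightarrow> s \<in> S \<Longrightarrow> \<exists>r\<in>R. (r, c, s) \<in> L"
proof -
  have sub: "L \<subseteq> R \<times> C \<times> S"
    and ex1: "\<forall>r\<in>R. \<forall>c\<in>C. \<exists>!s. (r, c, s) \<in> L" "\<forall>r\<in>R. \<forall>s\<in>S. \<exists>!c. (r, c, s) \<in> L"
      "\<forall>c\<in>C. \<forall>s\<in>S. \<exists>!r. (r, c, s) \<in> L"
    using assms by (simp_all add: latin_square_def)
  show "r \<in> R \<Longrightarrow> c \<in> C \<Longrightarrow> \<exists>s\<in>S. (r, c, s) \<in> L"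
    using ex1(1) sub by (metis SigmaD1 SigmaD2 subsetD)
  show "r \<in> R \<Longrightarrow> s \<in> S \<Longrightarrow> \<exists>c\<in>C. (r, c, s) \<in> L"
    using ex1(2) sub by (metis SigmaD1 SigmaD2 subsetD)
  show "c \<in> C \<Longrightarrow> s \<in> S \<Longrightarrow> \<exists>r\<in>R. (r, c, s) \<in> L"
    using ex1(3) sub by (metis SigmaD1 SigmaD2 subsetD)
qed

section \<open>The construction in the four blocks\<close>

text \<open>\<open>N\<close> misses exactly \<open>m\<close> rows, \<open>m\<close> columns and
  \<open>m\<close> symbols of \<open>A\<close>. One new triple for each of them gives the length
  \<open>(k - m) + 3 * m\<close>.\<close>

lemma maximal_partial_transversal_half_subsquare:
  assumes L: "latin_square (2 * k) R C S L"
    and A: "latin_square k R' C' S' A"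
    and R': "R' \<subseteq> R" and C': "C' \<subseteq> C" and AL: "A = submatrix L R' C'"
    and N: "partial_transversal A N" "card N + m = k"
    and m: "4 * m \<le> k"
  shows "\<exists>T. maximal_partial_transversal L T \<and> card T = k + 2 * m"
proof -
  let ?row = "\<lambda>t :: 'a \<times> 'b \<times> 'c. fst t"
  let ?col = "\<lambda>t :: 'a \<times> 'b \<times> 'c. fst (snd t)"
  let ?sym = "\<lambda>t :: 'a \<times> 'b \<times> 'c. snd (snd t)"
  note uniq = latin_square_unique[OF L]
  have fin: "finite R" "finite C" "finite S" and cards: "card R = 2 * k" "card C = 2 * k"
    and Lsub: "L \<subseteq> R \<times> C \<times> S"
    using L by (auto simp: latin_square_def)
  have fin': "finite R'" "finite C'" "finite S'"
    and cards': "card R' = k" "card C' = k" "card S' = k" and Asub: "A \<subseteq> R' \<times> C' \<times> S'"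
    using A by (auto simp: latin_square_def)
  have "A \<subseteq> L" by (auto simp: AL submatrix_def)
  have "finite L" using Lsub fin by (meson finite_SigmaI finite_subset)
  \<comment> \<open>The definition of a subsquare does not relate \<open>S'\<close> to
    \<open>S\<close>; the inclusion holds because each symbol of \<open>A\<close> occurs in a row of
    \<open>A\<close>, hence in \<open>L\<close>.\<close>
  have S': "S' \<subseteq> S"
  proof
    fix s assume "s \<in> S'"
    then have "R' \<noteq> {}" using cards' fin' by auto
    then show "s \<in> S" using latin_square_ex(2)[OF A _ \<open>s \<in> S'\<close>] \<open>A \<subseteq> L\<close> Lsub by blast
  qed
  have cR: "card (R - R') = k" and cC: "card (C - C') = k"
    using card_Diff_subset[OF fin'(1) R'] card_Diff_subset[OF fin'(2) C'] cards cards' by simp_all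
  \<comment> \<open>A row of \<open>A\<close> already contains every symbol of \<open>S'\<close>
    within the columns \<open>C'\<close>, so none of them recurs to the right. The next fact is the
    same for columns.\<close>
  have right_sym: "s \<in> S - S'" if "(r, c, s) \<in> L" "r \<in> R'" "c \<notin> C'" for r c s
    using that latin_square_ex(2)[OF A, of r s] \<open>A \<subseteq> L\<close> uniq(2) Lsub by blast
  have below_sym: "s \<in> S - S'" if "(r, c, s) \<in> L" "c \<in> C'" "r \<notin> R'" for r c s
    using that latin_square_ex(3)[OF A, of c s] \<open>A \<subseteq> L\<close> uniq(3) Lsub by blast
  have NA: "N \<subseteq> A" and Ninj: "inj_on ?row N" "inj_on ?col N" "inj_on ?sym N"
    using N(1) by (auto simp: partial_transversal_iff)
  have finN: "finite N" using NA \<open>A \<subseteq> L\<close> \<open>finite L\<close> by (meson finite_subset)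
  have Nsub: "?row ` N \<subseteq> R'" "?col ` N \<subseteq> C'" "?sym ` N \<subseteq> S'"
    using NA Asub by fastforce+
  have Nm: "?row t \<in> R' \<and> ?col t \<in> C' \<and> ?sym t \<in> S'" if "t \<in> N" for t
    using that Nsub by auto
  define XR XC XS where "XR = R' - ?row ` N" and "XC = C' - ?col ` N" and "XS = S' - ?sym ` N"
  have finX: "finite XR" "finite XC" "finite XS"
    using fin' by (simp_all add: XR_def XC_def XS_def)
  have cX: "card XR = m" "card XC = m" "card XS = m"
    using Nsub finN N(2) cards' Ninj
    by (simp_all add: XR_def XC_def XS_def card_Diff_subset card_image)

  \<comment> \<open>Covering the missing rows in the block to the right of \<open>A\<close>\<close>
  define PB where "PB x = {t \<in> L. ?row t = x \<and> ?col t \<in> C - C'}" for x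
  have PB: "finite (PB x) \<and> inj_on ?col (PB x) \<and> inj_on ?sym (PB x) \<and> ?row ` PB x \<subseteq> {x} \<and>
      ?col ` PB x \<subseteq> C - C' \<and> ?sym ` PB x \<subseteq> S - S' \<and> k \<le> card (PB x)" if "x \<in> XR" for x
  proof (intro conjI)
    have x: "x \<in> R'" using that by (simp add: XR_def)
    show fP: "finite (PB x)" using \<open>finite L\<close> by (simp add: PB_def)
    show "inj_on ?col (PB x)" "inj_on ?sym (PB x)"
      using uniq by (auto simp: PB_def inj_on_def)
    show "?row ` PB x \<subseteq> {x}" "?col ` PB x \<subseteq> C - C'" by (auto simp: PB_def)
    show "?sym ` PB x \<subseteq> S - S'" using right_sym x by (fastforce simp: PB_def)
    have "C - C' \<subseteq> ?col ` PB x"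
    proof
      fix c assume c: "c \<in> C - C'"
      then obtain s where "(x, c, s) \<in> L" using latin_square_ex(1)[OF L, of x c] x R' by auto
      then show "c \<in> ?col ` PB x" using c by (force simp: PB_def)
    qed
    then show "k \<le> card (PB x)"
      using surj_card_le[OF fP] cC by metis
  qed
  have zero: "{t \<in> N. ?col t \<in> C - C'} = {}" "{t \<in> N. ?sym t \<in> S - S'} = {}"
    using Nm by auto
  \<comment> \<open>\<open>N\<close> lies inside \<open>A\<close>, so it uses no column outside
    \<open>C'\<close> and no symbol outside \<open>S'\<close>: both conflict counts start at
    0.\<close>
  have roomB: "card {t \<in> N. ?col t \<in> C - C'} + card {t \<in> N. ?sym t \<in> S - S'} + 2 * card XR < k + 2"
    unfolding zero using m cX by simp
  have disjB: "?row ` N \<inter> XR = {}" by (auto simp: XR_def)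
  obtain UB where UB: "finite UB" "UB \<subseteq> (\<Union>x\<in>XR. PB x)" "?row ` UB = XR" "N \<inter> UB = {}"
    "card UB = card XR"
    "inj_on ?row (N \<union> UB)" "inj_on ?col (N \<union> UB)" "inj_on ?sym (N \<union> UB)"
    by (rule greedy_extension[OF finX(1) finN Ninj disjB PB roomB])
  have UBm: "t \<in> L \<and> ?row t \<in> R' \<and> ?col t \<in> C - C' \<and> ?sym t \<in> S - S'" if "t \<in> UB" for t
    using that UB(2) right_sym[of "?row t" "?col t" "?sym t"] by (auto simp: PB_def XR_def)

  \<comment> \<open>Covering the missing columns in the block below \<open>A\<close>\<close>
  let ?T1 = "N \<union> UB"
  have finT1: "finite ?T1" using finN UB(1) by simp
  define PC where "PC x = {t \<in> L. ?col t = x \<and> ?row t \<in> R - R'}" for x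
  have PC: "finite (PC x) \<and> inj_on ?row (PC x) \<and> inj_on ?sym (PC x) \<and> ?col ` PC x \<subseteq> {x} \<and>
      ?row ` PC x \<subseteq> R - R' \<and> ?sym ` PC x \<subseteq> S - S' \<and> k \<le> card (PC x)" if "x \<in> XC" for x
  proof (intro conjI)
    have x: "x \<in> C'" using that by (simp add: XC_def)
    show fP: "finite (PC x)" using \<open>finite L\<close> by (simp add: PC_def)
    show "inj_on ?row (PC x)" "inj_on ?sym (PC x)"
      using uniq by (auto simp: PC_def inj_on_def)
    show "?col ` PC x \<subseteq> {x}" "?row ` PC x \<subseteq> R - R'" by (auto simp: PC_def)
    show "?sym ` PC x \<subseteq> S - S'" using below_sym x by (fastforce simp: PC_def)
    have "R - R' \<subseteq> ?row ` PC x"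
    proof
      fix r assume r: "r \<in> R - R'"
      then obtain s where "(r, x, s) \<in> L" using latin_square_ex(1)[OF L, of r x] x C' by auto
      then show "r \<in> ?row ` PC x" using r by (force simp: PC_def)
    qed
    then show "k \<le> card (PC x)"
      using surj_card_le[OF fP] cR by metis
  qed
  have T1_row: "{t \<in> ?T1. ?row t \<in> R - R'} = {}" and T1_sym: "{t \<in> ?T1. ?sym t \<in> S - S'} \<subseteq> UB"
    using Nm UBm by auto
  \<comment> \<open>The rows below \<open>A\<close> are still free, and symbols outside
    \<open>S'\<close> are used only by the \<open>m\<close> triples of \<open>UB\<close>, so the sum
    is at most \<open>3 * m\<close>.\<close>
  have roomC: "card {t \<in> ?T1. ?row t \<in> R - R'} + card {t \<in> ?T1. ?sym t \<in> S - S'} + 2 * card XC < k + 2"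
    unfolding T1_row using card_mono[OF UB(1) T1_sym] UB(5) m cX by simp
  have disjC: "?col ` ?T1 \<inter> XC = {}" using UBm by (auto simp: XC_def)
  obtain UC where UC: "finite UC" "UC \<subseteq> (\<Union>x\<in>XC. PC x)" "?col ` UC = XC" "?T1 \<inter> UC = {}"
    "card UC = card XC"
    "inj_on ?col (?T1 \<union> UC)" "inj_on ?row (?T1 \<union> UC)" "inj_on ?sym (?T1 \<union> UC)"
    by (rule greedy_extension[OF finX(2) finT1 UB(7,6,8) disjC PC roomC])
  have UCm: "t \<in> L \<and> ?row t \<in> R - R' \<and> ?col t \<in> C' \<and> ?sym t \<in> S - S'" if "t \<in> UC" for t
    using that UC(2) below_sym[of "?row t" "?col t" "?sym t"] by (auto simp: PC_def XC_def)

  \<comment> \<open>Covering the missing symbols in the opposite block\<close>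
  let ?T2 = "?T1 \<union> UC"
  have finT2: "finite ?T2" using finT1 UC(1) by simp
  \<comment> \<open>The columns need no restriction here: for \<open>x\<close> in \<open>S'\<close>,
    \<open>below_sym\<close> keeps these triples out of the columns \<open>C'\<close>.\<close>
  define PD where "PD x = {t \<in> L. ?sym t = x \<and> ?row t \<in> R - R'}" for x
  have PD: "finite (PD x) \<and> inj_on ?row (PD x) \<and> inj_on ?col (PD x) \<and> ?sym ` PD x \<subseteq> {x} \<and>
      ?row ` PD x \<subseteq> R - R' \<and> ?col ` PD x \<subseteq> C - C' \<and> k \<le> card (PD x)" if "x \<in> XS" for x
  proof (intro conjI)
    have x: "x \<in> S'" using that by (simp add: XS_def)
    show fP: "finite (PD x)" using \<open>finite L\<close> by (simp add: PD_def)
    show "inj_on ?row (PD x)" "inj_on ?col (PD x)"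
      using uniq by (auto simp: PD_def inj_on_def)
    show "?sym ` PD x \<subseteq> {x}" "?row ` PD x \<subseteq> R - R'" by (auto simp: PD_def)
    show "?col ` PD x \<subseteq> C - C'" using below_sym x Lsub by (fastforce simp: PD_def)
    have "R - R' \<subseteq> ?row ` PD x"
    proof
      fix r assume r: "r \<in> R - R'"
      then obtain c where "(r, c, x) \<in> L" using latin_square_ex(2)[OF L, of r x] x S' by auto
      then show "r \<in> ?row ` PD x" using r by (force simp: PD_def)
    qed
    then show "k \<le> card (PD x)"
      using surj_card_le[OF fP] cR by metis
  qed
  have T2_row: "{t \<in> ?T2. ?row t \<in> R - R'} \<subseteq> UC" and T2_col: "{t \<in> ?T2. ?col t \<in> C - C'} \<subseteq> UB"
    using Nm UBm UCm by auto
  \<comment> \<open>The tightest of the three bounds: \<open>UC\<close> blocks at most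
    \<open>m\<close> rows and \<open>UB\<close> at most \<open>m\<close> columns, so the sum is at
    most \<open>4 * m\<close>, which is at most \<open>k\<close>.\<close>
  have roomD: "card {t \<in> ?T2. ?row t \<in> R - R'} + card {t \<in> ?T2. ?col t \<in> C - C'} + 2 * card XS < k + 2"
    using card_mono[OF UC(1) T2_row] card_mono[OF UB(1) T2_col] UB(5) UC(5) m cX by simp
  have disjD: "?sym ` ?T2 \<inter> XS = {}" using UBm UCm by (auto simp: XS_def)
  obtain UD where UD: "finite UD" "UD \<subseteq> (\<Union>x\<in>XS. PD x)" "?sym ` UD = XS" "?T2 \<inter> UD = {}"
    "card UD = card XS"
    "inj_on ?sym (?T2 \<union> UD)" "inj_on ?row (?T2 \<union> UD)" "inj_on ?col (?T2 \<union> UD)"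
    by (rule greedy_extension[OF finX(3) finT2 UC(8,7,6) disjD PD roomD])

  \<comment> \<open>Maximality and length\<close>
  let ?T = "?T2 \<union> UD"
  have "UD \<subseteq> L" using UD(2) by (auto simp: PD_def)
  then have "?T \<subseteq> L" using NA \<open>A \<subseteq> L\<close> UBm UCm by blast
  then have pt: "partial_transversal L ?T"
    using UD(6-8) by (simp add: partial_transversal_iff)
  have cover: "R' \<subseteq> ?row ` ?T" "C' \<subseteq> ?col ` ?T" "S' \<subseteq> ?sym ` ?T"
    using UB(3) UC(3) UD(3) by (auto simp: image_Un XR_def XC_def XS_def)
  \<comment> \<open>The opposite block carries only symbols of \<open>A\<close>: in a row outside
    \<open>R'\<close>, the \<open>k\<close> symbols of \<open>S'\<close> occupy \<open>k\<close>
    distinct columns, all outside \<open>C'\<close>, and therefore fill all of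
    \<open>C - C'\<close>.\<close>
  have block: "r \<in> R' \<or> c \<in> C' \<or> s \<in> S'" if "(r, c, s) \<in> L" for r c s
  proof (rule ccontr)
    assume H: "\<not> (r \<in> R' \<or> c \<in> C' \<or> s \<in> S')"
    then have r: "r \<in> R - R'" and c: "c \<in> C - C'" using that Lsub by auto
    let ?Q = "{t \<in> L. ?row t = r \<and> ?sym t \<in> S'}"
    have "?sym ` ?Q = S'"
    proof (intro equalityI subsetI)
      fix x assume x: "x \<in> S'"
      then obtain c where "(r, c, x) \<in> L" using latin_square_ex(2)[OF L, of r x] r S' by auto
      then show "x \<in> ?sym ` ?Q" using x by force
    qed auto
    then have "k \<le> card ?Q"
      using card_image_le[of ?Q ?sym] \<open>finite L\<close> cards' by simp
    also have "card ?Q = card (?col ` ?Q)"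
      using uniq by (intro card_image[symmetric]) (auto simp: inj_on_def)
    finally have "k \<le> card (?col ` ?Q)" .
    moreover have "?col ` ?Q \<subseteq> C - C'"
      using below_sym r Lsub by fastforce
    ultimately have "?col ` ?Q = C - C'"
      using cC fin(2) by (intro card_seteq) auto
    then have "c \<in> ?col ` ?Q" using c by simp
    then obtain t where "t \<in> ?Q" and ct: "c = ?col t" by (elim imageE)
    then have t: "t \<in> L" "?row t = r" "?sym t \<in> S'" by simp_all
    have "(r, c, ?sym t) \<in> L" using t(1) unfolding ct t(2)[symmetric] by simp
    then show False using uniq(1)[OF that] t(3) H by metis
  qed
  have "maximal_partial_transversal L ?T"
    using pt
  proof (rule maximal_partial_transversalI)
    fix r c s assume "(r, c, s) \<in> L"
    then show "r \<in> ?row ` ?T \<or> c \<in> ?col ` ?T \<or> s \<in> ?sym ` ?T"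
      using block cover by (meson subsetD)
  qed
  moreover have "card ?T = k + 2 * m"
    using UB(5) UC(5) UD(5) cX N(2)
    by (simp add: card_Un_disjoint[OF finN UB(1,4)] card_Un_disjoint[OF finT1 UC(1,4)]
        card_Un_disjoint[OF finT2 UD(1,4)])
  ultimately show ?thesis by blast
qed

section \<open>Choice of the parameters\<close>

theorem theorem5p6:
  fixes L A :: "('r \<times> 'c \<times> 's) set"
    and R :: "'r set" and C :: "'c set" and S :: "'s set"
    and n :: nat
  assumes "even n"
    and "latin_square n R C S L"
    and "subsquare (n div 2) A R C L"
    and "\<exists>N. near_transversal (n div 2) A N"
  shows "\<forall>l::int. int n < 2 * l \<and> 4 * l \<le> 3 * int n \<and> even (l - int (n div 2)) \<longrightarrow>
           (\<exists>T. maximal_partial_transversal L T \<and> int (card T) = l)"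
proof (intro allI impI)
  fix l :: int
  assume l: "int n < 2 * l \<and> 4 * l \<le> 3 * int n \<and> even (l - int (n div 2))"
  define k where "k = n div 2"
  have n: "n = 2 * k" using assms(1) by (simp add: k_def)
  obtain j where j: "l - int k = 2 * j" using l by (metis evenE k_def)
  define m where "m = nat j"
  \<comment> \<open>With \<open>l = k + 2 * j\<close> and \<open>n = 2 * k\<close>, the lower bound
    on \<open>l\<close> says \<open>j > 0\<close> and the upper bound says
    \<open>4 * j \<le> k\<close>.\<close>
  have m: "int m = j" "m \<ge> 1" "4 * m \<le> k" using l j n by (auto simp: m_def)
  obtain R' C' S' where sub: "R' \<subseteq> R" "C' \<subseteq> C" "A = submatrix L R' C'" "latin_square k R' C' S' A"
    using assms(3) by (auto simp: subsquare_def k_def)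
  obtain N where N: "partial_transversal A N" "card N + 1 = k"
    using assms(4) by (auto simp: near_transversal_def k_def)
  \<comment> \<open>A near-transversal is long enough since \<open>m \<ge> 1\<close>.\<close>
  have "k - m \<le> card N" using N(2) m by simp
  then obtain N' where N': "N' \<subseteq> N" "card N' = k - m"
    by (meson obtain_subset_with_card_n)
  have "\<exists>T. maximal_partial_transversal L T \<and> card T = k + 2 * m"
  proof (rule maximal_partial_transversal_half_subsquare)
    show "latin_square (2 * k) R C S L" using assms(2) n by simp
    show "partial_transversal A N'" using N(1) N'(1) by (rule partial_transversal_mono[OF _ order_refl])
    show "card N' + m = k" using N'(2) m by simp
  qed (use sub m in auto)
  moreover have "int (k + 2 * m) = l" using j m by simp
  ultimately show "\<exists>T. maximal_partial_transversal L T \<and> int (card T) = l" by metis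
qed

end
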